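(* Let $N\ge 1$, let $w$ be a weight on $(0,\infty)$ satisfying the standing assumptions in the context, and let $p_n$, $q_n$ ($0\le n\le N$) and $K_N$ be defined from $w$ as in the context. Then, for $x>0$, $$x\frac{d}{dx}p_n(x)=n\,p_n(x)+n\,\frac{\mathcal M[w](n+1)}{\mathcal M[w](n)}\,p_{n-1}(x)\qquad(1\le n\le N),$$ $$x\frac{d}{dx}q_n(x)=-\frac{(n+1)\,\mathcal M[w](n+2)}{\mathcal M[w](n+1)}\,q_{n+1}(x)-(n+1)\,q_n(x)\qquad(0\le n\le N-1).$$ As a corollary, for $x,y>0$, $$\Big(x\frac{\partial}{\partial x}+y\frac{\partial}{\partial y}+1\Big)K_N(x,y)=-N\,\frac{\mathcal M[w](N+1)}{\mathcal M[w](N)}\,p_{N-1}(x)\,q_N(y),$$ and this implies $$K_N(x,y)=-N\,\frac{\mathcal M[w](N+1)}{\mathcal M[w](N)}\int_0^1 p_{N-1}(xt)\,q_N(yt)\,dt .$$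
   Context: The Mellin transform of $w$ is $\mathcal M[w](s)=\int_0^\infty y^{s-1}w(y)\,dy$. Standing assumptions on $w:(0,\infty)\to\mathbb R$: $w$ is $N$ times continuously differentiable; $\mathcal M[w](n+1)$ exists (absolutely convergent integral) and is nonzero for $n=0,1,\dots,N$; and the functions $\big(x\frac{d}{dx}\big)^l w(x)$, $0\le l\le N$, are integrable on $(0,\infty)$. For $0\le n\le N$ define $$p_n(x)=(-1)^n\,n!\,\mathcal M[w](n+1)\sum_{j=0}^n\frac{(-x)^j}{j!\,(n-j)!\,\mathcal M[w](j+1)},$$ $$q_n(x)=\frac{1}{n!\,\mathcal M[w](n+1)}\,\frac{d^n}{dx^n}\Big((-x)^n w(x)\Big),$$ and define the correlation kernel $K_N(x,y)=\sum_{j=0}^{N-1}p_j(x)\,q_j(y)$. *)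

theory Defs
  imports "HOL-Analysis.Analysis"
begin

text \<open>
  Functions on the half-line \<open>(0, \<infinity>)\<close> are represented by total functions on the reals;
  their values outside the half-line play no role.
\<close>

text \<open>Intended for open \<open>S\<close>, since \<open>deriv\<close> is the two-sided derivative.\<close>

definition times_cont_diff_on :: "nat \<Rightarrow> (real \<Rightarrow> real) \<Rightarrow> real set \<Rightarrow> bool" where
  "times_cont_diff_on k f S \<longleftrightarrow>
     (\<forall>i<k. \<forall>x\<in>S. ((deriv ^^ i) f) differentiable (at x)) \<and>
     (\<forall>i\<le>k. continuous_on S ((deriv ^^ i) f))"

definition mellin_integrand :: "(real \<Rightarrow> real) \<Rightarrow> real \<Rightarrow> real \<Rightarrow> real" where
  "mellin_integrand w s y = y powr (s - 1) * w y"

text \<open>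
  Absolute convergence of the integral: Lebesgue integrability of the integrand.
\<close>

definition mellin_exists :: "(real \<Rightarrow> real) \<Rightarrow> real \<Rightarrow> bool" where
  "mellin_exists w s \<longleftrightarrow> set_integrable lborel {0<..} (mellin_integrand w s)"

definition mellin :: "(real \<Rightarrow> real) \<Rightarrow> real \<Rightarrow> real" where
  "mellin w s = (LINT y:{0<..}|lborel. mellin_integrand w s y)"

definition euler_op :: "(real \<Rightarrow> real) \<Rightarrow> real \<Rightarrow> real" where
  "euler_op f = (\<lambda>x. x * deriv f x)"

definition admissible_weight :: "nat \<Rightarrow> (real \<Rightarrow> real) \<Rightarrow> bool" where
  "admissible_weight N w \<longleftrightarrow>
     times_cont_diff_on N w {0<..} \<and>
     (\<forall>n\<le>N. mellin_exists w (real n + 1) \<and> mellin w (real n + 1) \<noteq> 0) \<and>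
     (\<forall>l\<le>N. set_integrable lborel {0<..} ((euler_op ^^ l) w))"

definition p_fun :: "(real \<Rightarrow> real) \<Rightarrow> nat \<Rightarrow> real \<Rightarrow> real" where
  "p_fun w n x = (-1) ^ n * fact n * mellin w (real n + 1) *
     (\<Sum>j=0..n. (- x) ^ j / (fact j * fact (n - j) * mellin w (real j + 1)))"

definition q_fun :: "(real \<Rightarrow> real) \<Rightarrow> nat \<Rightarrow> real \<Rightarrow> real" where
  "q_fun w n x = 1 / (fact n * mellin w (real n + 1)) *
     (deriv ^^ n) (\<lambda>u. (- u) ^ n * w u) x"

definition corr_kernel :: "(real \<Rightarrow> real) \<Rightarrow> nat \<Rightarrow> real \<Rightarrow> real \<Rightarrow> real" where
  "corr_kernel w N x y = (\<Sum>j<N. p_fun w j x * q_fun w j y)"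

end

theory Submission
  imports Defs
begin

text \<open>
  The recurrence for \<open>q\<^sub>n\<close> comes from applying the Leibniz rule to \<open>- x \<cdot> (- x)\<^sup>n w(x)\<close>; with both
  recurrences the sum over \<open>j\<close> of the terms of the kernel equation telescopes. For the integral formula,
  put \<open>F(t) = t K\<^sub>N(xt, yt)\<close>: the kernel equation says that \<open>F'\<close> is the integrand on the right. Each
  \<open>q\<^sub>n\<close> is a linear combination of the \<open>(x d/dx)\<^sup>l w\<close> with \<open>l \<le> n\<close>, hence integrable, so \<open>F'\<close> and
  \<open>F(t) / t\<close> are integrable on \<open>(0, 1)\<close>. The former gives \<open>F\<close> a limit at \<open>0\<close> and the latter
  forces it to be \<open>0\<close>, so no decay of \<open>w\<close> at the origin has to be assumed.
\<close>

section \<open>Iterated derivatives\<close>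

text \<open>The differentiability clause of \<open>times_cont_diff_on\<close>, isolated because it
  passes to derivatives, to products with linear factors and to images under
  \<open>euler_op\<close>.\<close>

definition times_diff_on :: "nat \<Rightarrow> (real \<Rightarrow> real) \<Rightarrow> real set \<Rightarrow> bool" where
  "times_diff_on k f S \<longleftrightarrow> (\<forall>i<k. \<forall>x\<in>S. (deriv ^^ i) f differentiable (at x))"

lemma iter_deriv_cong:
  fixes f g :: "real \<Rightarrow> real"
  assumes "open S" and "\<And>x. x \<in> S \<Longrightarrow> f x = g x" and "x \<in> S"
  shows "(deriv ^^ i) f x = (deriv ^^ i) g x"
proof (rule higher_deriv_cong_ev)
  have "eventually (\<lambda>u. u \<in> S) (nhds x)"
    using assms by (simp add: eventually_nhds_in_open)
  then show "eventually (\<lambda>u. f u = g u) (nhds x)"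
    by eventually_elim (rule assms(2))
qed simp

lemma has_derivative_iter_deriv:
  assumes "times_diff_on k f S" "i < k" "x \<in> S"
  shows "((deriv ^^ i) f has_real_derivative (deriv ^^ Suc i) f x) (at x)"
  using assms by (simp add: times_diff_on_def DERIV_deriv_iff_real_differentiable)

lemma times_diff_on_deriv:
  assumes "times_diff_on (Suc k) f S"
  shows "times_diff_on k (deriv f) S"
  using assms unfolding times_diff_on_def
  by (metis Suc_less_eq funpow_Suc_right o_apply)

text \<open>Leibniz's rule for the linear factor \<open>c * u\<close> has two terms; this is its
  induction step from order \<open>i\<close> to \<open>Suc i\<close>. At \<open>i = 0\<close> the
  truncated index \<open>i - 1\<close> is harmless because its coefficient vanishes.\<close>

lemma iter_deriv_linear_mult_has_derivative:
  assumes "times_diff_on k f S" "i < k" "x \<in> S"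
  shows "((\<lambda>u. c * (u * (deriv ^^ i) f u + real i * (deriv ^^ (i - 1)) f u)) has_real_derivative
     c * (x * (deriv ^^ Suc i) f x + real (Suc i) * (deriv ^^ i) f x)) (at x)"
proof (cases i)
  case 0
  show ?thesis
    using has_derivative_iter_deriv[OF assms] unfolding 0
    by (auto intro!: derivative_eq_intros)
next
  case (Suc j)
  have "((deriv ^^ j) f has_real_derivative (deriv ^^ i) f x) (at x)"
    using has_derivative_iter_deriv[OF assms(1), of j x] assms Suc by simp
  then show ?thesis
    using has_derivative_iter_deriv[OF assms] Suc
    by (auto intro!: derivative_eq_intros simp: algebra_simps)
qed

lemma iter_deriv_linear_mult:
  assumes "open S" "times_diff_on k f S" "i \<le> k" "x \<in> S"
  shows "(deriv ^^ i) (\<lambda>u. c * u * f u) x =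
    c * (x * (deriv ^^ i) f x + real i * (deriv ^^ (i - 1)) f x)"
  using assms(3,4)
proof (induction i arbitrary: x)
  case 0
  then show ?case by simp
next
  case (Suc i)
  let ?g = "\<lambda>u. c * (u * (deriv ^^ i) f u + real i * (deriv ^^ (i - 1)) f u)"
  \<comment> \<open>The induction hypothesis holds on all of the open \<open>S\<close>, so it may be
    differentiated at \<open>x\<close>.\<close>
  have "(deriv ^^ Suc i) (\<lambda>u. c * u * f u) x = deriv ?g x"
    using iter_deriv_cong[OF \<open>open S\<close>, of "(deriv ^^ i) (\<lambda>u. c * u * f u)" ?g x 1] Suc by simp
  also have "\<dots> = c * (x * (deriv ^^ Suc i) f x + real (Suc i) * (deriv ^^ i) f x)"
    using iter_deriv_linear_mult_has_derivative[OF assms(2)] Suc.prems by (simp add: DERIV_imp_deriv)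
  finally show ?case by simp
qed

lemma times_diff_on_linear_mult:
  assumes "open S" "times_diff_on k f S"
  shows "times_diff_on k (\<lambda>u. c * u * f u) S"
  unfolding times_diff_on_def
proof (intro allI impI ballI)
  fix i x assume i: "i < k" and x: "x \<in> S"
  have "eventually (\<lambda>u. u \<in> S) (nhds x)"
    using \<open>open S\<close> x by (simp add: eventually_nhds_in_open)
  then have "eventually (\<lambda>u. (deriv ^^ i) (\<lambda>u. c * u * f u) u =
      c * (u * (deriv ^^ i) f u + real i * (deriv ^^ (i - 1)) f u)) (nhds x)"
    using iter_deriv_linear_mult[OF assms] i by (auto elim!: eventually_mono)
  from DERIV_cong_ev[OF refl this refl] iter_deriv_linear_mult_has_derivative[OF assms(2) i x]
  show "(deriv ^^ i) (\<lambda>u. c * u * f u) differentiable (at x)"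
    using real_differentiable_def by blast
qed

lemma times_diff_on_neg_power_mult:
  assumes "open S" "times_diff_on k f S"
  shows "times_diff_on k (\<lambda>u. (- u) ^ n * f u) S"
proof (induction n)
  case 0
  then show ?case using assms by simp
next
  case (Suc n)
  from times_diff_on_linear_mult[OF assms(1) Suc, of "- 1"] show ?case
    by (simp add: mult.assoc)
qed

text \<open>Each application of \<open>euler_op\<close> costs one order of differentiability; its
  linear factor costs none. Once \<open>l \<ge> k\<close> the truncated difference is
  \<open>0\<close> and the claim is empty.\<close>

lemma times_diff_on_euler_op:
  assumes "open S" "times_diff_on k f S"
  shows "times_diff_on (k - l) ((euler_op ^^ l) f) S"
proof (induction l)
  case 0
  then show ?case using assms by simp
next
  case (Suc l)
  show ?case
  proof (cases "k - l")
    case 0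
    then show ?thesis by (simp add: times_diff_on_def)
  next
    case (Suc m)
    then have "times_diff_on m (deriv ((euler_op ^^ l) f)) S"
      using Suc.IH by (simp add: times_diff_on_deriv)
    from times_diff_on_linear_mult[OF assms(1) this, of 1] have
      "times_diff_on m (euler_op ((euler_op ^^ l) f)) S"
      by (simp add: euler_op_def[abs_def])
    moreover have "k - Suc l = m" using Suc by simp
    ultimately show ?thesis by simp
  qed
qed

section \<open>The functions \<open>p\<^sub>n\<close> and \<open>q\<^sub>n\<close>\<close>

text \<open>The operator x d/dx multiplies the monomial of degree \<open>j\<close> by
  \<open>j\<close>. Subtracting \<open>n\<close> times the polynomial therefore removes the top
  term, and (j - n) / (n - j)! = -1 / (n - 1 - j)! leaves the sum in \<open>p_fun w (n - 1)\<close>.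
  The case \<open>n = 0\<close> is included, with no condition on \<open>mellin w 0\<close>, because
  the kernel sum starts there.\<close>

lemma p_fun_has_derivative:
  assumes "n \<ge> 1 \<Longrightarrow> mellin w (real n) \<noteq> 0"
  shows "\<exists>d. (p_fun w n has_real_derivative d) (at x) \<and>
    x * d = real n * p_fun w n x
          + real n * (mellin w (real n + 1) / mellin w (real n)) * p_fun w (n - 1) x"
proof (cases n)
  case 0
  then have "p_fun w n = (\<lambda>x. p_fun w n 0)"
    by (auto simp: p_fun_def fun_eq_iff)
  then have "(p_fun w n has_real_derivative 0) (at x)"
    by (metis DERIV_const)
  then show ?thesis using 0 by auto
next
  case (Suc m)
  define M where "M j = mellin w (real j + 1)" for j
  define C where "C = (-1) ^ n * fact n * M n"
  define d where "d = C * (\<Sum>j=0..n. - (real j * (- x) ^ (j - 1)) / (fact j * fact (n - j) * M j))"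
  have D: "(p_fun w n has_real_derivative d) (at x)"
    unfolding d_def p_fun_def[abs_def] C_def M_def
    by (intro DERIV_cmult DERIV_sum DERIV_cdivide) (auto intro!: derivative_eq_intros)
  have xj: "x * - (real j * (- x) ^ (j - 1)) = real j * (- x) ^ j" for j
    by (cases j) auto
  have "x * d = C * (\<Sum>j=0..n. (x * - (real j * (- x) ^ (j - 1))) / (fact j * fact (n - j) * M j))"
    by (simp add: d_def sum_distrib_left mult_ac)
  then have "x * d = C * (\<Sum>j=0..n. real j * (- x) ^ j / (fact j * fact (n - j) * M j))"
    unfolding xj .
  then have "x * d - real n * p_fun w n x =
      C * (\<Sum>j=0..n. (real j - real n) * (- x) ^ j / (fact j * fact (n - j) * M j))"
    unfolding p_fun_def M_def[symmetric] C_def[symmetric]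
    by (simp add: sum_distrib_left sum_subtractf[symmetric] left_diff_distrib right_diff_distrib
        diff_divide_distrib mult_ac)
  also have "\<dots> = C * (\<Sum>j=0..m. (real j - real n) * (- x) ^ j / (fact j * fact (n - j) * M j))"
    using Suc by simp
  also have "(\<Sum>j=0..m. (real j - real n) * (- x) ^ j / (fact j * fact (n - j) * M j)) =
      (\<Sum>j=0..m. - ((- x) ^ j / (fact j * fact (m - j) * M j)))"
  proof (rule sum.cong[OF refl])
    fix j assume "j \<in> {0..m}"
    then have j: "j \<le> m" by simp
    define k where "k = real (Suc (m - j))"
    have "real j - real n = - k" "fact (n - j) = k * fact (m - j)" "k \<noteq> 0"
      using Suc j by (auto simp: k_def Suc_diff_le of_nat_diff)
    then show "(real j - real n) * (- x) ^ j / (fact j * fact (n - j) * M j) =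
      - ((- x) ^ j / (fact j * fact (m - j) * M j))"
      by simp
  qed
  \<comment> \<open>The minus sign turns \<open>(-1) ^ n\<close> into \<open>(-1) ^ m\<close>,
    \<open>fact n = n * fact m\<close> yields the factor \<open>n\<close>, and \<open>M m\<close>
    cancels against the normalization of \<open>p_fun w m\<close>.\<close>
  also have "C * \<dots> = real n * (M n / M m) * p_fun w m x"
    using assms Suc unfolding p_fun_def C_def M_def sum_negf
    by (simp add: add.commute)
  finally show ?thesis
    using D Suc unfolding M_def by (auto simp: algebra_simps)
qed

text \<open>Since \<open>(- u) ^ Suc n * w u = - u * ((- u) ^ n * w u)\<close>, this is the two-term
  Leibniz rule of order \<open>Suc n\<close> with \<open>c = - 1\<close>.\<close>

lemma iter_deriv_neg_power_mult_Suc: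
  assumes "open S" "times_diff_on (Suc n) w S" "x \<in> S"
  shows "(deriv ^^ Suc n) (\<lambda>u. (- u) ^ Suc n * w u) x =
    - x * deriv ((deriv ^^ n) (\<lambda>u. (- u) ^ n * w u)) x
    - real (Suc n) * (deriv ^^ n) (\<lambda>u. (- u) ^ n * w u) x"
  using iter_deriv_linear_mult[OF assms(1) times_diff_on_neg_power_mult[OF assms(1,2)] order_refl assms(3),
      of "- 1" n]
  by (simp add: algebra_simps)

lemma q_fun_has_derivative:
  assumes "times_diff_on (Suc n) w {0<..}" "mellin w (real n + 2) \<noteq> 0" "x > 0"
  shows "\<exists>d. (q_fun w n has_real_derivative d) (at x) \<and>
    x * d = - (((real n + 1) * mellin w (real n + 2)) / mellin w (real n + 1)) * q_fun w (n + 1) x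
          - (real n + 1) * q_fun w n x"
proof -
  define Q where "Q n = (deriv ^^ n) (\<lambda>u. (- u) ^ n * w u)" for n
  define c where "c n = 1 / (fact n * mellin w (real n + 1))" for n
  have q: "q_fun w n = (\<lambda>x. c n * Q n x)" for n
    by (simp add: fun_eq_iff q_fun_def c_def Q_def)
  have D: "(Q n has_real_derivative deriv (Q n) x) (at x)"
    using has_derivative_iter_deriv[OF times_diff_on_neg_power_mult[OF _ assms(1)], of n x n] assms(3)
    by (simp add: Q_def)
  have rec: "x * deriv (Q n) x = - Q (Suc n) x - (real n + 1) * Q n x"
    using iter_deriv_neg_power_mult_Suc[OF _ assms(1), of x] assms(3) unfolding Q_def by simp
  \<comment> \<open>The factor in the recurrence is the ratio of consecutive normalizing constants.
    If \<open>mellin w (real n + 1)\<close> is \<open>0\<close>, both sides are \<open>0\<close>, as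
    division by zero gives \<open>0\<close>.\<close>
  have c: "((real n + 1) * mellin w (real n + 2)) / mellin w (real n + 1) * c (Suc n) = c n"
    using assms(2) of_nat_neq_0[of n, where ?'a = real] unfolding c_def
    by (simp add: add_ac divide_simps)
  have "((q_fun w n) has_real_derivative c n * deriv (Q n) x) (at x)"
    unfolding q by (rule DERIV_cmult[OF D])
  moreover have "x * (c n * deriv (Q n) x) =
    - (((real n + 1) * mellin w (real n + 2)) / mellin w (real n + 1) * c (Suc n)) * Q (Suc n) x
    - (real n + 1) * (c n * Q n x)"
    unfolding c mult.left_commute[of x] rec by (simp add: algebra_simps)
  ultimately show ?thesis
    unfolding q by (metis Suc_eq_plus1 mult.assoc mult_minus_left)
qed

text \<open>With D for x d/dx and Q_n for the left-hand side, the recurrence reads Q_{n+1} = -(D + n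
  + 1) Q_n, so Q_n is a polynomial in D applied to \<open>w\<close>. This carries the integrability
  of the \<open>(euler_op ^^ l) w\<close> over to \<open>q_fun\<close>.\<close>

lemma neg_power_deriv_eq_euler_sum:
  assumes "times_diff_on N w {0<..}" "n \<le> N"
  shows "\<exists>c. \<forall>x>0. (deriv ^^ n) (\<lambda>u. (- u) ^ n * w u) x = (\<Sum>l\<le>n. c l * (euler_op ^^ l) w x)"
  using assms(2)
proof (induction n)
  case 0
  then show ?case by (auto intro!: exI[of _ "\<lambda>_. 1"])
next
  case (Suc n)
  define Q where "Q = (deriv ^^ n) (\<lambda>u. (- u) ^ n * w u)"
  let ?e = "\<lambda>l. (euler_op ^^ l) w"
  from Suc obtain c where c: "\<And>x. x > 0 \<Longrightarrow> Q x = (\<Sum>l\<le>n. c l * ?e l x)"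
    unfolding Q_def by auto
  \<comment> \<open>The coefficients after applying -(D + n + 1): the \<open>if\<close> pads the old
    ones with \<open>0\<close> at \<open>l = Suc n\<close>, and the \<open>case\<close> shifts them
    by one, with \<open>0\<close> at \<open>l = 0\<close>.\<close>
  define c' where "c' l = - (real (Suc n) * (if l \<le> n then c l else 0))
      - (case l of 0 \<Rightarrow> 0 | Suc k \<Rightarrow> c k)" for l
  have "(deriv ^^ Suc n) (\<lambda>u. (- u) ^ Suc n * w u) x = (\<Sum>l\<le>Suc n. c' l * ?e l x)" if x: "x > 0" for x
  proof -
    have dw: "times_diff_on (Suc n) w {0<..}"
      using assms(1) Suc.prems by (auto simp: times_diff_on_def)
    have e: "(?e l has_real_derivative deriv (?e l) x) (at x)" if "l \<le> n" for l
    proof -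
      \<comment> \<open>As \<open>l \<le> n < N\<close>, the \<open>l\<close>-th iterate has at
        least one order of differentiability left.\<close>
      have "0 < N - l" using that Suc.prems by simp
      from has_derivative_iter_deriv[OF times_diff_on_euler_op[OF _ assms(1)] this, of x] x
      show ?thesis by simp
    qed
    have "deriv Q x = deriv (\<lambda>x. \<Sum>l\<le>n. c l * ?e l x) x"
      using iter_deriv_cong[of "{0<..}" Q "\<lambda>x. \<Sum>l\<le>n. c l * ?e l x" x 1] c x by simp
    also have "\<dots> = (\<Sum>l\<le>n. c l * deriv (?e l) x)"
      by (rule DERIV_imp_deriv) (auto intro!: DERIV_sum DERIV_cmult e)
    finally have "x * deriv Q x = (\<Sum>l\<le>n. c l * ?e (Suc l) x)"
      by (simp add: sum_distrib_left euler_op_def mult_ac)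
    then have "(deriv ^^ Suc n) (\<lambda>u. (- u) ^ Suc n * w u) x =
        - (\<Sum>l\<le>n. c l * ?e (Suc l) x) - real (Suc n) * (\<Sum>l\<le>n. c l * ?e l x)"
      using iter_deriv_neg_power_mult_Suc[OF _ dw, of x] c[OF x] x unfolding Q_def by simp
    also have "\<dots> = (\<Sum>l\<le>Suc n. c' l * ?e l x)"
    proof -
      have "(\<Sum>l\<le>Suc n. c' l * ?e l x) =
        - (real (Suc n) * (\<Sum>l\<le>Suc n. (if l \<le> n then c l else 0) * ?e l x))
        - (\<Sum>l\<le>Suc n. (case l of 0 \<Rightarrow> 0 | Suc k \<Rightarrow> c k) * ?e l x)"
        unfolding c'_def by (simp only: sum_distrib_left sum_negf[symmetric] sum_subtractf[symmetric])
          (auto intro!: sum.cong simp: algebra_simps)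
      also have "(\<Sum>l\<le>Suc n. (if l \<le> n then c l else 0) * ?e l x) = (\<Sum>l\<le>n. c l * ?e l x)"
        by simp
      also have "(\<Sum>l\<le>Suc n. (case l of 0 \<Rightarrow> 0 | Suc k \<Rightarrow> c k) * ?e l x) = (\<Sum>l\<le>n. c l * ?e (Suc l) x)"
        by (subst sum.atMost_Suc_shift) simp
      finally show ?thesis by simp
    qed
    finally show ?thesis .
  qed
  then show ?case by blast
qed

section \<open>Integrability on the half-line\<close>

lemma set_integrable_sum:
  fixes f :: "'a \<Rightarrow> 'b \<Rightarrow> real"
  assumes "\<And>i. i \<in> I \<Longrightarrow> set_integrable M A (f i)"
  shows "set_integrable M A (\<lambda>x. \<Sum>i\<in>I. f i x)"
  using assms unfolding set_integrable_def scaleR_sum_right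
  by (rule Bochner_Integration.integrable_sum)

lemma q_fun_integrable:
  assumes "admissible_weight N w" "n \<le> N"
  shows "set_integrable lborel {0<..} (q_fun w n)"
proof -
  have "times_diff_on N w {0<..}"
    using assms(1) by (auto simp: admissible_weight_def times_cont_diff_on_def times_diff_on_def)
  from neg_power_deriv_eq_euler_sum[OF this assms(2)] obtain c where
    c: "\<And>x. x > 0 \<Longrightarrow> (deriv ^^ n) (\<lambda>u. (- u) ^ n * w u) x = (\<Sum>l\<le>n. c l * (euler_op ^^ l) w x)"
    by auto
  have "set_integrable lborel {0<..} (\<lambda>x. 1 / (fact n * mellin w (real n + 1)) *
      (\<Sum>l\<le>n. c l * (euler_op ^^ l) w x))"
    using assms by (intro set_integrable_mult_right set_integrable_sum)
      (auto simp: admissible_weight_def)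
  then show ?thesis
    by (rule set_integrable_cong[THEN iffD1, OF refl refl, rotated]) (simp add: q_fun_def c)
qed

lemma set_integrable_scale:
  fixes f :: "real \<Rightarrow> real"
  assumes "set_integrable lborel {0<..} f" "y > 0"
  shows "set_integrable lborel {0<..} (\<lambda>t. f (y * t))"
proof -
  have "integrable lborel (\<lambda>t. indicat_real {0<..} (0 + y * t) *\<^sub>R f (0 + y * t))"
    using assms unfolding set_integrable_def by (intro lborel_integrable_real_affine) auto
  moreover have "indicat_real {0<..} (0 + y * t) = indicat_real {0<..} t" for t
    using assms(2) by (simp add: indicator_def zero_less_mult_iff)
  ultimately show ?thesis by (simp add: set_integrable_def)
qed

text \<open>\<open>g\<close> is continuous also at \<open>0\<close>, hence bounded on the compact
  \<open>{0..b}\<close>, and a multiple of \<open>f\<close> dominates the product. In the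
  application \<open>g\<close> is a rescaled \<open>p_fun\<close> and \<open>f\<close> a rescaled
  \<open>q_fun\<close>.\<close>

lemma set_integrable_continuous_mult:
  fixes f g :: "real \<Rightarrow> real"
  assumes "continuous_on UNIV g" "set_integrable lborel {0<..} f"
  shows "set_integrable lborel {0<..b} (\<lambda>t. g t * f t)"
proof -
  have f: "set_integrable lborel {0<..b} f"
    using assms(2) by (rule set_integrable_subset) auto
  have "compact (g ` {0..b})"
    using assms(1) by (intro compact_continuous_image) (auto intro: continuous_on_subset)
  then obtain B where B: "\<And>t. t \<in> {0..b} \<Longrightarrow> \<bar>g t\<bar> \<le> B"
    using compact_imp_bounded bounded_iff by (metis imageI real_norm_def)
  have g: "g \<in> borel_measurable borel"
    using assms(1) by (rule borel_measurable_continuous_onI)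
  have "(\<lambda>t. indicat_real {0<..b} t *\<^sub>R f t) \<in> borel_measurable lborel"
    using f unfolding set_integrable_def by (rule borel_measurable_integrable)
  then have "(\<lambda>t. g t * (indicat_real {0<..b} t *\<^sub>R f t)) \<in> borel_measurable lborel"
    using g by (intro borel_measurable_times) auto
  then have m: "(\<lambda>t. indicat_real {0<..b} t *\<^sub>R (g t * f t)) \<in> borel_measurable lborel"
    by (simp add: mult_ac)
  have "integrable lborel (\<lambda>t. B * (indicat_real {0<..b} t *\<^sub>R f t))"
    using f unfolding set_integrable_def by (rule integrable_mult_right)
  then show ?thesis
    unfolding set_integrable_def
  proof (rule Bochner_Integration.integrable_bound[OF _ m], intro AE_I2)
    fix t
    show "norm (indicat_real {0<..b} t *\<^sub>R (g t * f t)) \<le> norm (B * (indicat_real {0<..b} t *\<^sub>R f t))"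
      using B[of t] by (auto simp: indicator_def abs_mult intro!: mult_right_mono)
  qed
qed

section \<open>Primitives on a half-open interval\<close>

text \<open>\<open>F t\<close> is \<open>F b\<close> minus the integral of \<open>h\<close> over
  \<open>{t..b}\<close>, which is continuous in \<open>t\<close> down to \<open>0\<close>.\<close>

lemma primitive_tendsto_at_0:
  fixes F h :: "real \<Rightarrow> real"
  assumes "b > 0" and h: "set_integrable lborel {0<..b} h"
    and F: "\<And>t. 0 < t \<Longrightarrow> t \<le> b \<Longrightarrow> (F has_real_derivative h t) (at t)"
  shows "(F \<longlongrightarrow> F b - (LINT t:{0<..b}|lborel. h t)) (at_right 0)"
proof -
  have i: "h integrable_on {0<..b}" "(LINT t:{0<..b}|lborel. h t) = integral {0<..b} h"
    using set_borel_integral_eq_integral[OF h] by auto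
  \<comment> \<open>The two intervals differ only in the point \<open>0\<close>, so the integral may
    be taken over the closed one.\<close>
  have sp: "negligible ({x \<in> {0<..b} - {0..b}. h x \<noteq> 0})" "negligible ({x \<in> {0..b} - {0<..b}. h x \<noteq> 0})"
    by (auto intro: negligible_subset[of "{0}"])
  have i0: "h integrable_on {0..b}" 
    by (rule integrable_spike_set[OF i(1) sp])
  have eq: "integral {0<..b} h = integral {0..b} h"
    by (rule integral_spike_set[OF sp])
  have "continuous_on {0..b} (\<lambda>t. integral {t..b} h)"
    by (rule indefinite_integral_continuous_1'[OF i0])
  then have "((\<lambda>t. integral {t..b} h) \<longlongrightarrow> integral {0..b} h) (at 0 within {0..b})"
    using \<open>b > 0\<close> by (auto simp: continuous_on_def)
  then have "((\<lambda>t. integral {t..b} h) \<longlongrightarrow> integral {0..b} h) (at_right 0)"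
    using \<open>b > 0\<close> by (simp add: at_within_Icc_at_right)
  then have "((\<lambda>t. F b - integral {t..b} h) \<longlongrightarrow> F b - integral {0..b} h) (at_right 0)"
    by (intro tendsto_intros)
  moreover have "eventually (\<lambda>t. F b - integral {t..b} h = F t) (at_right 0)"
    using eventually_at_right_real[OF \<open>b > 0\<close>]
  proof (eventually_elim)
    case (elim t)
    have "(h has_integral F b - F t) {t..b}"
      using elim F by (intro fundamental_theorem_of_calculus)
        (auto simp: has_real_derivative_iff_has_vector_derivative[symmetric] intro: has_field_derivative_at_within)
    then show ?case by (simp add: integral_unique)
  qed
  ultimately show ?thesis
    unfolding i(2) eq by (rule Lim_transform_eventually)
qed

text \<open>Integrability would give the primitive \<open>ln\<close> a finite limit at
  \<open>0\<close>, but it tends to minus infinity.\<close>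

lemma not_set_integrable_inverse:
  fixes b :: real
  assumes "b > 0"
  shows "\<not> set_integrable lborel {0<..b} (\<lambda>t. 1 / t)"
proof
  assume "set_integrable lborel {0<..b} (\<lambda>t. 1 / t)"
  then have "(ln \<longlongrightarrow> ln b - (LINT t:{0<..b}|lborel. 1 / t)) (at_right 0)"
    by (intro primitive_tendsto_at_0 assms) (auto intro!: derivative_eq_intros)
  moreover have "filterlim (ln :: real \<Rightarrow> real) at_infinity (at_right 0)"
    using ln_at_0 filterlim_at_bot_imp_at_infinity by blast
  ultimately show False
    using not_tendsto_and_filterlim_at_infinity trivial_limit_at_right_real by blast
qed

text \<open>The primitive has a limit at \<open>0\<close>, which must vanish since \<open>1 / t\<close> is not integrable there.\<close>

lemma primitive_eq_integral:
  fixes F h :: "real \<Rightarrow> real"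
  assumes "b > 0" and h: "set_integrable lborel {0<..b} h"
    and F: "\<And>t. 0 < t \<Longrightarrow> t \<le> b \<Longrightarrow> (F has_real_derivative h t) (at t)"
    and Fi: "set_integrable lborel {0<..b} (\<lambda>t. F t / t)"
  shows "F b = (LINT t:{0<..b}|lborel. h t)"
proof (rule ccontr)
  define L where "L = F b - (LINT t:{0<..b}|lborel. h t)"
  assume "F b \<noteq> (LINT t:{0<..b}|lborel. h t)"
  then have L: "\<bar>L\<bar> > 0" by (simp add: L_def)
  have "((\<lambda>t. \<bar>F t\<bar>) \<longlongrightarrow> \<bar>L\<bar>) (at_right 0)"
    unfolding L_def by (intro tendsto_rabs primitive_tendsto_at_0 assms)
  then have "eventually (\<lambda>t. \<bar>L\<bar> / 2 < \<bar>F t\<bar>) (at_right 0)"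
    using L by (auto dest!: order_tendstoD(1)[where a = "\<bar>L\<bar> / 2"])
  then obtain d where d: "d > 0" "\<And>t. 0 < t \<Longrightarrow> t < d \<Longrightarrow> \<bar>L\<bar> / 2 < \<bar>F t\<bar>"
    by (auto simp: eventually_at_right_field)
  \<comment> \<open>The bound on \<open>F\<close> holds for \<open>t < d\<close> only, while the
    interval is closed at \<open>e\<close>; halving \<open>d\<close> keeps \<open>e\<close> strictly
    below it.\<close>
  define e where "e = min b (d / 2)"
  have e: "e > 0" "e \<le> b" "e < d" using d \<open>b > 0\<close> by (auto simp: e_def)
  have "set_integrable lborel {0<..e} (\<lambda>t. F t / t)"
    using Fi by (rule set_integrable_subset) (use e in auto)
  \<comment> \<open>The factor \<open>2 / \<bar>L\<bar>\<close> comes from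
    \<open>\<bar>L\<bar> / 2 < \<bar>F t\<bar>\<close>: it makes this function dominate
    \<open>1 / t\<close> in absolute value.\<close>
  then have "set_integrable lborel {0<..e} (\<lambda>t. 2 / \<bar>L\<bar> * (F t / t))"
    by (rule set_integrable_mult_right)
  then have "set_integrable lborel {0<..e} (\<lambda>t. 1 / t)"
    unfolding set_integrable_def
  proof (rule Bochner_Integration.integrable_bound, goal_cases)
    case 1
    then show ?case by measurable
  next
    case 2
    have "1 / t \<le> 2 / \<bar>L\<bar> * (\<bar>F t\<bar> / t)" if "0 < t" "t \<le> e" for t
      using d(2)[of t] that e L by (simp add: field_simps)
    then show ?case
      by (intro AE_I2) (auto simp: indicator_def abs_mult)
  qed
  then show False using not_set_integrable_inverse e by blast
qed

section \<open>The correlation kernel\<close>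

text \<open>Pure algebra in the values \<open>P' n\<close> and \<open>Q' n\<close>: the diagonal
  terms cancel because n - (n + 1) + 1 = 0, and only the cross terms remain.\<close>

lemma corr_kernel_telescope:
  assumes "N \<ge> 1"
    and p: "\<And>n. n < N \<Longrightarrow> P' n = real n * p_fun w n x
          + real n * (mellin w (real n + 1) / mellin w (real n)) * p_fun w (n - 1) x"
    and q: "\<And>n. n < N \<Longrightarrow> Q' n =
          - (((real n + 1) * mellin w (real n + 2)) / mellin w (real n + 1)) * q_fun w (n + 1) y
          - (real n + 1) * q_fun w n y"
  shows "(\<Sum>n<N. P' n * q_fun w n y) + (\<Sum>n<N. p_fun w n x * Q' n) + corr_kernel w N x y =
    - real N * (mellin w (real N + 1) / mellin w (real N)) * p_fun w (N - 1) x * q_fun w N y"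
proof -
  \<comment> \<open>The cross term from the recurrence of \<open>p_fun\<close> is
    \<open>- T n\<close>, the one from \<open>q_fun\<close> is \<open>T (Suc n)\<close>. The factor
    \<open>real n\<close> makes \<open>T 0\<close> vanish.\<close>
  define T where "T n = - real n * (mellin w (real n + 1) / mellin w (real n))
    * p_fun w (n - 1) x * q_fun w n y" for n
  have "(\<Sum>n<N. P' n * q_fun w n y) + (\<Sum>n<N. p_fun w n x * Q' n) + corr_kernel w N x y =
      (\<Sum>n<N. P' n * q_fun w n y + p_fun w n x * Q' n + p_fun w n x * q_fun w n y)"
    by (simp add: corr_kernel_def sum.distrib)
  also have "\<dots> = (\<Sum>n<N. T (Suc n) - T n)"
    by (rule sum.cong[OF refl]) (simp add: p q T_def algebra_simps add_divide_distrib diff_divide_distrib)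
  also have "\<dots> = T N - T 0"
    by (rule sum_lessThan_telescope)
  finally show ?thesis by (simp add: T_def)
qed

text \<open>\<open>deriv\<close> and the Lebesgue integral are total, so differentiability and
  integrability are asserted next to the equations to give these their usual meaning.\<close>

theorem proposition2p1:
  fixes N :: nat and w :: "real \<Rightarrow> real"
  assumes "1 \<le> N" and "admissible_weight N w"
  shows
    "(\<forall>n x. 1 \<le> n \<and> n \<le> N \<and> 0 < x \<longrightarrow>
        p_fun w n differentiable (at x) \<and>
        x * deriv (p_fun w n) x =
          real n * p_fun w n x
          + real n * (mellin w (real n + 1) / mellin w (real n)) * p_fun w (n - 1) x) \<and>
     (\<forall>n x. n \<le> N - 1 \<and> 0 < x \<longrightarrow>
        q_fun w n differentiable (at x) \<and>
        x * deriv (q_fun w n) x =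
          - (((real n + 1) * mellin w (real n + 2)) / mellin w (real n + 1)) * q_fun w (n + 1) x
          - (real n + 1) * q_fun w n x) \<and>
     (\<forall>x y. 0 < x \<and> 0 < y \<longrightarrow>
        (\<lambda>u. corr_kernel w N u y) differentiable (at x) \<and>
        (\<lambda>v. corr_kernel w N x v) differentiable (at y) \<and>
        x * deriv (\<lambda>u. corr_kernel w N u y) x
          + y * deriv (\<lambda>v. corr_kernel w N x v) y
          + corr_kernel w N x y =
          - real N * (mellin w (real N + 1) / mellin w (real N)) * p_fun w (N - 1) x * q_fun w N y) \<and>
     (\<forall>x y. 0 < x \<and> 0 < y \<longrightarrow>
        set_integrable lborel {0<..<1} (\<lambda>t. p_fun w (N - 1) (x * t) * q_fun w N (y * t)) \<and>
        corr_kernel w N x y =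
          - real N * (mellin w (real N + 1) / mellin w (real N))
          * (LINT t:{0<..<1}|lborel. p_fun w (N - 1) (x * t) * q_fun w N (y * t)))"
proof -
  define A where "A = - real N * (mellin w (real N + 1) / mellin w (real N))"
  have td: "times_diff_on N w {0<..}"
    using assms(2) by (auto simp: admissible_weight_def times_cont_diff_on_def times_diff_on_def)
  have nz: "mellin w (real n + 1) \<noteq> 0" if "n \<le> N" for n
    using assms(2) that by (auto simp: admissible_weight_def)
  have nz1: "mellin w (real n) \<noteq> 0" if "n \<ge> 1" "n \<le> N" for n
    using nz[of "n - 1"] that by simp
  have nz2: "mellin w (real n + 2) \<noteq> 0" if "n < N" for n
    using nz[of "Suc n"] that by (simp add: add.commute)

  have pD: "(p_fun w n has_real_derivative deriv (p_fun w n) x) (at x)"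
    and pE: "x * deriv (p_fun w n) x = real n * p_fun w n x
          + real n * (mellin w (real n + 1) / mellin w (real n)) * p_fun w (n - 1) x"
    if "n \<le> N" for n x
    using p_fun_has_derivative[of n w x] nz1 that by (auto simp: DERIV_imp_deriv)
  have qD: "(q_fun w n has_real_derivative deriv (q_fun w n) x) (at x)"
    and qE: "x * deriv (q_fun w n) x =
          - (((real n + 1) * mellin w (real n + 2)) / mellin w (real n + 1)) * q_fun w (n + 1) x
          - (real n + 1) * q_fun w n x"
    if "n < N" "x > 0" for n x
  proof -
    have "times_diff_on (Suc n) w {0<..}"
      using td that by (auto simp: times_diff_on_def)
    from q_fun_has_derivative[OF this nz2[OF that(1)] that(2)]
    show "(q_fun w n has_real_derivative deriv (q_fun w n) x) (at x)"
      "x * deriv (q_fun w n) x =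
          - (((real n + 1) * mellin w (real n + 2)) / mellin w (real n + 1)) * q_fun w (n + 1) x
          - (real n + 1) * q_fun w n x"
      by (auto simp: DERIV_imp_deriv)
  qed

  have KX: "((\<lambda>u. corr_kernel w N u y) has_real_derivative
      (\<Sum>n<N. deriv (p_fun w n) x * q_fun w n y)) (at x)" for x y
    unfolding corr_kernel_def by (intro DERIV_sum DERIV_cmult_right pD) auto
  have KY: "((\<lambda>v. corr_kernel w N x v) has_real_derivative
      (\<Sum>n<N. p_fun w n x * deriv (q_fun w n) y)) (at y)" if "y > 0" for x y
    unfolding corr_kernel_def using that by (intro DERIV_sum DERIV_cmult qD) auto
  have PDE: "(\<Sum>n<N. (x * deriv (p_fun w n) x) * q_fun w n y)
      + (\<Sum>n<N. p_fun w n x * (y * deriv (q_fun w n) y)) + corr_kernel w N x y =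
      A * p_fun w (N - 1) x * q_fun w N y" if "y > 0" for x y
    unfolding A_def by (rule corr_kernel_telescope[OF assms(1)]) (use that in \<open>simp_all only: pE qE less_imp_le\<close>)

  \<comment> \<open>The interval includes \<open>1\<close>, to fit
    \<open>primitive_eq_integral\<close>.\<close>
  have pq: "set_integrable lborel {0<..1} (\<lambda>t. p_fun w m (x * t) * q_fun w n (y * t))"
    if "m \<le> N" "n \<le> N" "y > 0" for m n x y
  proof (rule set_integrable_continuous_mult)
    show "continuous_on UNIV (\<lambda>t. p_fun w m (x * t))"
    proof -
      have "continuous_on UNIV (p_fun w m)"
        using pD[OF that(1)] by (rule DERIV_continuous_on)
      from continuous_on_compose2[OF this, of UNIV "\<lambda>t. x * t"] show ?thesis
        by (auto intro: continuous_intros)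
    qed
    show "set_integrable lborel {0<..} (\<lambda>t. q_fun w n (y * t))"
      by (intro set_integrable_scale q_fun_integrable[OF assms(2)] that)
  qed

  have I: "set_integrable lborel {0<..<1} (\<lambda>t. p_fun w (N - 1) (x * t) * q_fun w N (y * t))" (is ?I)
    and E: "corr_kernel w N x y =
      A * (LINT t:{0<..<1}|lborel. p_fun w (N - 1) (x * t) * q_fun w N (y * t))" (is ?E)
    if "x > 0" "y > 0" for x y
  proof -
    let ?h = "\<lambda>t. p_fun w (N - 1) (x * t) * q_fun w N (y * t)"
    let ?F = "\<lambda>t. t * corr_kernel w N (x * t) (y * t)"
    have h: "set_integrable lborel {0<..1} ?h"
      using pq that by simp
    then show ?I
      by (rule set_integrable_subset) auto
    have "?F 1 = (LINT t:{0<..1}|lborel. A * ?h t)"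
    proof (rule primitive_eq_integral)
      show "set_integrable lborel {0<..1} (\<lambda>t. A * ?h t)"
        using h by (rule set_integrable_mult_right)
      \<comment> \<open>For \<open>t > 0\<close>, \<open>?F t / t\<close> is the kernel along the
        ray, a finite sum of products covered by \<open>pq\<close>.\<close>
      have "set_integrable lborel {0<..1} (\<lambda>t. corr_kernel w N (x * t) (y * t))"
        unfolding corr_kernel_def using that by (intro set_integrable_sum pq) auto
      then show "set_integrable lborel {0<..1} (\<lambda>t. ?F t / t)"
        by (rule set_integrable_cong[THEN iffD1, OF refl refl, rotated]) auto
      fix t :: real assume t: "0 < t" "t \<le> 1"
      have p': "((\<lambda>t. p_fun w n (x * t)) has_real_derivative deriv (p_fun w n) (x * t) * x) (at t)"
        if "n < N" for n
        using that pD[of n "x * t"]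
        by (intro DERIV_chain2[of "p_fun w n"]) (auto intro!: derivative_eq_intros)
      have q': "((\<lambda>t. q_fun w n (y * t)) has_real_derivative deriv (q_fun w n) (y * t) * y) (at t)"
        if "n < N" for n
        using that qD[of n "y * t"] t \<open>y > 0\<close>
        by (intro DERIV_chain2[of "q_fun w n"]) (auto intro!: derivative_eq_intros)
      define d where "d = (\<Sum>n<N. deriv (p_fun w n) (x * t) * x * q_fun w n (y * t)
          + deriv (q_fun w n) (y * t) * y * p_fun w n (x * t))"
      have "((\<lambda>t. corr_kernel w N (x * t) (y * t)) has_real_derivative d) (at t)"
        unfolding corr_kernel_def d_def by (intro DERIV_sum DERIV_mult p' q') auto
      then have "(?F has_real_derivative corr_kernel w N (x * t) (y * t) + t * d) (at t)"
        by (auto intro!: derivative_eq_intros)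
      \<comment> \<open>The kernel equation at \<open>(x * t, y * t)\<close>: \<open>t * d\<close>
        is the sum of its two Euler terms, and the product rule for the factor \<open>t\<close>
        supplies the remaining kernel term.\<close>
      also have "corr_kernel w N (x * t) (y * t) + t * d = A * ?h t"
        using PDE[of "y * t" "x * t"] t \<open>y > 0\<close>
        by (simp add: d_def sum.distrib sum_distrib_left algebra_simps)
      finally show "(?F has_real_derivative A * ?h t) (at t)" .
    qed simp
    also have "\<dots> = A * (LINT t:{0<..1}|lborel. ?h t)"
      by simp
    also have "(LINT t:{0<..1}|lborel. ?h t) = (LINT t:{0<..<1}|lborel. ?h t)"
      by (rule set_integral_discrete_difference[where X = "{1}"]) auto
    finally show ?E by simp
  qed

  show ?thesis
  proof (intro conjI allI impI; (elim conjE)?)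
    fix n x assume "1 \<le> n" "n \<le> N" "(0::real) < x"
    then show "p_fun w n differentiable (at x)"
      "x * deriv (p_fun w n) x = real n * p_fun w n x
          + real n * (mellin w (real n + 1) / mellin w (real n)) * p_fun w (n - 1) x"
      using pD[of n x] pE[of n x] by (auto simp: real_differentiable_def)
  next
    fix n and x :: real assume "n \<le> N - 1" "0 < x"
    \<comment> \<open>With \<open>N \<ge> 1\<close> the truncated \<open>N - 1\<close> is a true
      predecessor.\<close>
    then have n: "n < N" "0 < x" using assms(1) by auto
    show "q_fun w n differentiable (at x)"
      using qD[OF n] by (auto simp: real_differentiable_def)
    show "x * deriv (q_fun w n) x =
          - (((real n + 1) * mellin w (real n + 2)) / mellin w (real n + 1)) * q_fun w (n + 1) x
          - (real n + 1) * q_fun w n x"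
      by (rule qE[OF n])
  next
    fix x y :: real assume xy: "0 < x" "0 < y"
    show "(\<lambda>u. corr_kernel w N u y) differentiable (at x)"
      "(\<lambda>v. corr_kernel w N x v) differentiable (at y)"
      using KX[of y x] KY[OF xy(2), of x] by (auto simp: real_differentiable_def)
    show "x * deriv (\<lambda>u. corr_kernel w N u y) x
          + y * deriv (\<lambda>v. corr_kernel w N x v) y
          + corr_kernel w N x y =
          - real N * (mellin w (real N + 1) / mellin w (real N)) * p_fun w (N - 1) x * q_fun w N y"
      using PDE[OF xy(2), of x] unfolding DERIV_imp_deriv[OF KX] DERIV_imp_deriv[OF KY[OF xy(2)]] A_def
      by (simp add: sum_distrib_left mult_ac)
  next
    fix x y :: real assume xy: "0 < x" "0 < y"
    show "set_integrable lborel {0<..<1} (\<lambda>t. p_fun w (N - 1) (x * t) * q_fun w N (y * t))"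
      by (rule I[OF xy])
    show "corr_kernel w N x y =
          - real N * (mellin w (real N + 1) / mellin w (real N))
          * (LINT t:{0<..<1}|lborel. p_fun w (N - 1) (x * t) * q_fun w N (y * t))"
      using E[OF xy] unfolding A_def .
  qed
qed

end
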